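(* Let $\mathcal{L}$ be an integer lexicon and $\mathcal{B}_{\mathcal{L}}$ the set of all integer linear constraints over $\mathcal{L}$. Let $P=\langle\Pi,\mathcal{B}_{\mathcal{L}},\gamma\rangle$ be a constraint answer set program over the vocabulary $\sigma=\sigma_r\cup\sigma_i$, and let $X$ be a set of atoms from $\sigma$. Then $X$ is an answer set of $P$ if and only if there is a model $X\cup X_i$, with $X_i\subseteq\sigma_i^{R(\Pi,\sigma_i)}$, of the constraint formula $\langle IComp(\Pi,\sigma_i)\wedge R(\Pi,\sigma_i),\ \mathcal{B}_{\mathcal{L}}\cup\mathcal{B}_{R(\Pi,\sigma_i)},\ \gamma'\rangle$ over $\sigma_r\cup\sigma_i\cup\sigma_i^{R(\Pi,\sigma_i)}$ (regular atoms $\sigma_r$, irregular atoms $\sigma_i\cup\sigma_i^{R(\Pi,\sigma_i)}$), where $\gamma'$ coincides with $\gamma$ on $\sigma_i$ and with $\gamma^{R(\Pi,\sigma_i)}$ on $\sigma_i^{R(\Pi,\sigma_i)}$, and all these constraints are interpreted over the integer lexicon whose variables are those of $\mathcal{L}$ together with $\Sigma^{R(\Pi,\sigma_i)}$ (assumed disjoint).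
   Context: Logic programs. A program $\Pi$ over a vocabulary (set of atoms) $\sigma$ is a set of rules $a\leftarrow b_1,\ldots,b_\ell,\ not\ b_{\ell+1},\ldots,\ not\ b_m,\ not\ not\ b_{m+1},\ldots,\ not\ not\ b_n$ ($a\in\sigma$ or $\bot$, $b_i\in\sigma$), identified with $B\rightarrow a$ where $B=b_1\wedge\cdots\wedge b_\ell\wedge\neg b_{\ell+1}\wedge\cdots\wedge\neg b_m\wedge\neg\neg b_{m+1}\wedge\cdots\wedge\neg\neg b_n$ is the body, $B^+=\{b_1,\dots,b_\ell\}$ its positive part and the rest its negative part. Sets of atoms are identified with assignments making exactly their atoms true. $hd(\Pi)$: heads that are atoms; $Bodies(\Pi,a)$: bodies of rules with head $a$; $At(\Pi)$, $At(F)$: atoms occurring. Reduct $\Pi^X$: delete rules whose negative part $X$ does not satisfy, replace the rest by $a\leftarrow b_1,..,b_\ell$; $X$ is an answer set if it is a minimal set satisfying $\Pi^X$. For $\iota\subseteq\sigma$ with $hd(\Pi)\cap\iota=\emptyset$: $X$ is an input answer set of $\Pi$ relative to $\iota$ if it is an answer set of $\Pi\cup\{a.\mid a\in X\cap\iota\}$; $IComp(\Pi,\iota)$ is the conjunction of the rules of $\Pi$ and the implications $a\rightarrow\bigvee_{B\in Bodies(\Pi,a)}B$ for all $a\in\sigma\setminus\iota$ (empty disjunction $=\bot$). Integer linear constraints. An integer lexicon over a set $V$ of variables has domain $\mathbb{Z}$, binary predicate symbols $<,>,\leq,\geq,=,\neq$ and binary function symbols $+,\times$ with usual meanings. An integer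 linear constraint is $a_1x_1+\cdots+a_nx_n\bowtie k$ with $a_j,k\in\mathbb{Z}$, $x_j\in V$, $\bowtie\in\{<,>,\leq,\geq,=,\neq\}$; a valuation $\nu:V\to\mathbb{Z}$ satisfies it if the relation holds, and satisfies $\neg c$ if $c$ fails ($\neg\neg c$ identified with $c$). A GCSP is a finite set of constraints; a solution is a valuation satisfying all of them. The formula $R(\Pi,\iota)$. For each atom $a$ let $lr_a$ be an integer variable and for atoms $a,b$ let $|lr_a-1\geq lr_b|$ be a fresh propositional atom. $R(\Pi,\iota)$ is the conjunction over all $a\in\sigma\setminus\iota$ of $a\rightarrow\bigvee_{a\leftarrow B\in\Pi,\ B^+\setminus\iota\neq\emptyset}\big(B\wedge\bigwedge_{b\in B^+\setminus\iota}|lr_a-1\geq lr_b|\big)\vee\bigvee_{a\leftarrow B\in\Pi,\ B^+\setminus\iota=\emptyset}B$. $\sigma_i^{R(\Pi,\iota)}$ is the set of atoms $|lr_a-1\geq lr_b|$ occurring in it, $\Sigma^{R(\Pi,\iota)}$ the set of variables occurring in them, $\gamma^{R(\Pi,\iota)}$ maps $|lr_a-1\geq lr_b|$ to the constraint $lr_a-1\geq lr_b$, and $\mathcal{B}_{R(\Pi,\iota)}$ is the set of all integer linear constraints over the integer lexicon with variables $\Sigma^{R(\Pi,\iota)}$. CAS programs and constraint formulas. For disjoint $\sigma_r$ (regular) and $\sigma_i$ (irregular atoms), a constraint answer set program $\langle\Pi,\mathcal{B},\gamma\rangle$ over $\sigma_r\cup\sigma_i$ has $\Pi$ a program with $hd(\Pi)\cap\sigma_i=\emptyset$,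 $\mathcal{B}$ a set of constraints over a lexicon, $\gamma:\sigma_i\to\mathcal{B}$ injective; $X\subseteq At(\Pi)$ is an answer set if it is an input answer set of $\Pi$ relative to $\sigma_i$ and the GCSP $\{\gamma(a)\mid a\in X\cap\sigma_i\}\cup\{\neg\gamma(a)\mid a\in(At(\Pi)\cap\sigma_i)\setminus X\}$ has a solution. A constraint formula $\langle F,\mathcal{B},\gamma\rangle$ has as models the $Y\subseteq At(F)$ satisfying $F$ such that the GCSP $\{\gamma(a)\mid a\in Y\cap\sigma_i\}\cup\{\neg\gamma(a)\mid a\in(At(F)\cap\sigma_i)\setminus Y\}$ has a solution. *)

theory Defs
  imports Main "HOL-Library.FSet"
begin

datatype (atoms: 'a) fm =
    Atom 'a
  | Bot
  | Neg "'a fm"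
  | Imp "'a fm" "'a fm"
  | Conj "'a fm fset"
  | Disj "'a fm fset"

text \<open>An assignment is the set of the atoms that it makes true.\<close>

primrec sat :: "'a set \<Rightarrow> 'a fm \<Rightarrow> bool" where
  "sat X (Atom a) \<longleftrightarrow> a \<in> X"
| "sat X Bot \<longleftrightarrow> False"
| "sat X (Neg F) \<longleftrightarrow> \<not> sat X F"
| "sat X (Imp F G) \<longleftrightarrow> (sat X F \<longrightarrow> sat X G)"
| "sat X (Conj Fs) \<longleftrightarrow> fBall (sat X |`| Fs) (\<lambda>b. b)"
| "sat X (Disj Fs) \<longleftrightarrow> fBex (sat X |`| Fs) (\<lambda>b. b)"

lemma sat_Conj_iff: "sat X (Conj Fs) \<longleftrightarrow> (\<forall>F. F |\<in>| Fs \<longrightarrow> sat X F)"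
  by auto

lemma sat_Disj_iff: "sat X (Disj Fs) \<longleftrightarrow> (\<exists>F. F |\<in>| Fs \<and> sat X F)"
  by auto

text \<open>Since \<^const>\<open>Abs_fset\<close> is specified only on finite sets, the next two
  notions are meaningful only for finite \<open>S\<close>.\<close>

definition conj_of :: "'a fm set \<Rightarrow> 'a fm" where
  "conj_of S = Conj (Abs_fset S)"

definition disj_of :: "'a fm set \<Rightarrow> 'a fm" where
  "disj_of S = Disj (Abs_fset S)"


text \<open>A body consists of the atoms \<open>b\<close> that occur in it as \<open>b\<close>, as \<open>not b\<close> and as
  \<open>not not b\<close>, respectively. The head \<open>None\<close> stands for falsity.\<close>

datatype 'a body = Body (pos: "'a list") (neg: "'a list") (dneg: "'a list")

datatype 'a rule = Rule (head: "'a option") (body: "'a body")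

definition body_fm :: "'a body \<Rightarrow> 'a fm" where
  "body_fm B = Conj (Atom |`| fset_of_list (pos B)
     |\<union>| (\<lambda>b. Neg (Atom b)) |`| fset_of_list (neg B)
     |\<union>| (\<lambda>b. Neg (Neg (Atom b))) |`| fset_of_list (dneg B))"

definition rule_fm :: "'a rule \<Rightarrow> 'a fm" where
  "rule_fm r = Imp (body_fm (body r)) (case head r of None \<Rightarrow> Bot | Some a \<Rightarrow> Atom a)"

definition prog_atoms :: "'a rule set \<Rightarrow> 'a set" where
  "prog_atoms \<Pi> = (\<Union>r\<in>\<Pi>. set_rule r)"

definition hd_atoms :: "'a rule set \<Rightarrow> 'a set" where
  "hd_atoms \<Pi> = {a. \<exists>r\<in>\<Pi>. head r = Some a}"

definition bodies :: "'a rule set \<Rightarrow> 'a \<Rightarrow> 'a body set" where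
  "bodies \<Pi> a = {B. Rule (Some a) B \<in> \<Pi>}"

text \<open>Finiteness is what makes the disjunctions over the rules of a program below
  propositional formulas, and the GCSPs of a constraint answer set program finite.\<close>

definition program_over :: "'a set \<Rightarrow> 'a rule set \<Rightarrow> bool" where
  "program_over \<sigma> \<Pi> \<longleftrightarrow> finite \<Pi> \<and> prog_atoms \<Pi> \<subseteq> \<sigma>"

definition sat_prog :: "'a set \<Rightarrow> 'a rule set \<Rightarrow> bool" where
  "sat_prog X \<Pi> \<longleftrightarrow> (\<forall>r\<in>\<Pi>. sat X (rule_fm r))"

definition sat_neg_part :: "'a set \<Rightarrow> 'a body \<Rightarrow> bool" where
  "sat_neg_part X B \<longleftrightarrow> set (neg B) \<inter> X = {} \<and> set (dneg B) \<subseteq> X"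

definition reduct :: "'a rule set \<Rightarrow> 'a set \<Rightarrow> 'a rule set" where
  "reduct \<Pi> X = {Rule (head r) (Body (pos (body r)) [] []) | r. r \<in> \<Pi> \<and> sat_neg_part X (body r)}"

definition answer_set :: "'a rule set \<Rightarrow> 'a set \<Rightarrow> bool" where
  "answer_set \<Pi> X \<longleftrightarrow>
     sat_prog X (reduct \<Pi> X) \<and> (\<forall>Y. Y \<subset> X \<longrightarrow> \<not> sat_prog Y (reduct \<Pi> X))"

definition fact :: "'a \<Rightarrow> 'a rule" where
  "fact a = Rule (Some a) (Body [] [] [])"

definition input_answer_set :: "'a rule set \<Rightarrow> 'a set \<Rightarrow> 'a set \<Rightarrow> bool" where
  "input_answer_set \<Pi> \<iota> X \<longleftrightarrow> answer_set (\<Pi> \<union> fact ` (X \<inter> \<iota>)) X"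

definition IComp :: "'a set \<Rightarrow> 'a rule set \<Rightarrow> 'a set \<Rightarrow> 'a fm" where
  "IComp \<sigma> \<Pi> \<iota> = conj_of (rule_fm ` \<Pi> \<union>
     (\<lambda>a. Imp (Atom a) (disj_of (body_fm ` bodies \<Pi> a))) ` (\<sigma> - \<iota>))"


datatype crel = Lt | Gt | Le | Ge | Eq | Ne

primrec holds :: "crel \<Rightarrow> int \<Rightarrow> int \<Rightarrow> bool" where
  "holds Lt x y \<longleftrightarrow> x < y"
| "holds Gt x y \<longleftrightarrow> x > y"
| "holds Le x y \<longleftrightarrow> x \<le> y"
| "holds Ge x y \<longleftrightarrow> x \<ge> y"
| "holds Eq x y \<longleftrightarrow> x = y"
| "holds Ne x y \<longleftrightarrow> x \<noteq> y"

text \<open>Constraints are syntactic objects: \<open>LinC [(a1, x1), \<dots>, (an, xn)] R k\<close> is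
  \<open>a1 x1 + \<dots> + an xn R k\<close>, so that different expressions of the same relation are
  different constraints.\<close>

datatype 'v lin_constraint = LinC "(int \<times> 'v) list" crel int

primrec con_vars :: "'v lin_constraint \<Rightarrow> 'v set" where
  "con_vars (LinC ts R k) = snd ` set ts"

text \<open>The integer linear constraints over the integer lexicon with set of variables \<open>V\<close>.\<close>

definition int_constraints :: "'v set \<Rightarrow> 'v lin_constraint set" where
  "int_constraints V = {c. con_vars c \<subseteq> V}"

text \<open>Valuations are total; their values outside the variables of the lexicon do not matter.\<close>

primrec sat_con :: "('v \<Rightarrow> int) \<Rightarrow> 'v lin_constraint \<Rightarrow> bool" where
  "sat_con \<nu> (LinC ts R k) \<longleftrightarrow> holds R (\<Sum>(a, x)\<leftarrow>ts. a * \<nu> x) k"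

text \<open>The elements of a GCSP are constraints and negated constraints.\<close>

datatype 'v con_lit = Con "'v lin_constraint" | NotCon "'v lin_constraint"

primrec sat_lit :: "('v \<Rightarrow> int) \<Rightarrow> 'v con_lit \<Rightarrow> bool" where
  "sat_lit \<nu> (Con c) \<longleftrightarrow> sat_con \<nu> c"
| "sat_lit \<nu> (NotCon c) \<longleftrightarrow> \<not> sat_con \<nu> c"

definition has_solution :: "'v con_lit set \<Rightarrow> bool" where
  "has_solution \<Gamma> \<longleftrightarrow> (\<exists>\<nu>. \<forall>l\<in>\<Gamma>. sat_lit \<nu> l)"

text \<open>The GCSP that the set \<open>X\<close> induces on the irregular atoms \<open>\<sigma>\<^sub>i\<close>, where \<open>A\<close> is the set of
  the atoms that occur in the program or formula.\<close>

definition gcsp :: "'a set \<Rightarrow> 'a set \<Rightarrow> ('a \<Rightarrow> 'v lin_constraint) \<Rightarrow> 'a set \<Rightarrow> 'v con_lit set" where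
  "gcsp A \<sigma>\<^sub>i \<gamma> X = {Con (\<gamma> a) | a. a \<in> X \<inter> \<sigma>\<^sub>i} \<union> {NotCon (\<gamma> a) | a. a \<in> (A \<inter> \<sigma>\<^sub>i) - X}"


text \<open>The set \<open>V\<close> of the variables of the lexicon and the sets \<open>\<sigma>\<^sub>r\<close> and \<open>\<sigma>\<^sub>i\<close> of regular and
  irregular atoms are separate arguments.\<close>

type_synonym ('a, 'v) cas = "'a rule set \<times> 'v lin_constraint set \<times> ('a \<Rightarrow> 'v lin_constraint)"

type_synonym ('a, 'v) cfm = "'a fm \<times> 'v lin_constraint set \<times> ('a \<Rightarrow> 'v lin_constraint)"

fun cas_program :: "'v set \<Rightarrow> 'a set \<Rightarrow> 'a set \<Rightarrow> ('a, 'v) cas \<Rightarrow> bool" where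
  "cas_program V \<sigma>\<^sub>r \<sigma>\<^sub>i (\<Pi>, \<B>, \<gamma>) \<longleftrightarrow>
     \<sigma>\<^sub>r \<inter> \<sigma>\<^sub>i = {} \<and> program_over (\<sigma>\<^sub>r \<union> \<sigma>\<^sub>i) \<Pi> \<and> hd_atoms \<Pi> \<inter> \<sigma>\<^sub>i = {} \<and>
     \<B> \<subseteq> int_constraints V \<and> \<gamma> ` \<sigma>\<^sub>i \<subseteq> \<B> \<and> inj_on \<gamma> \<sigma>\<^sub>i"

fun cas_answer_set :: "'a set \<Rightarrow> ('a, 'v) cas \<Rightarrow> 'a set \<Rightarrow> bool" where
  "cas_answer_set \<sigma>\<^sub>i (\<Pi>, \<B>, \<gamma>) X \<longleftrightarrow>
     X \<subseteq> prog_atoms \<Pi> \<and> input_answer_set \<Pi> \<sigma>\<^sub>i X \<and> has_solution (gcsp (prog_atoms \<Pi>) \<sigma>\<^sub>i \<gamma> X)"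

fun constraint_formula :: "'v set \<Rightarrow> 'a set \<Rightarrow> 'a set \<Rightarrow> ('a, 'v) cfm \<Rightarrow> bool" where
  "constraint_formula V \<sigma>\<^sub>r \<sigma>\<^sub>i (F, \<B>, \<gamma>) \<longleftrightarrow>
     \<sigma>\<^sub>r \<inter> \<sigma>\<^sub>i = {} \<and> atoms F \<subseteq> \<sigma>\<^sub>r \<union> \<sigma>\<^sub>i \<and>
     \<B> \<subseteq> int_constraints V \<and> \<gamma> ` \<sigma>\<^sub>i \<subseteq> \<B> \<and> inj_on \<gamma> \<sigma>\<^sub>i"

fun cfm_model :: "'a set \<Rightarrow> ('a, 'v) cfm \<Rightarrow> 'a set \<Rightarrow> bool" where
  "cfm_model \<sigma>\<^sub>i (F, \<B>, \<gamma>) Y \<longleftrightarrow>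
     Y \<subseteq> atoms F \<and> sat Y F \<and> has_solution (gcsp (atoms F) \<sigma>\<^sub>i \<gamma> Y)"


text \<open>In the following, \<open>rk a b\<close> is the propositional atom \<open>|lr a - 1 \<ge> lr b|\<close>.\<close>

definition ranking_fm :: "('a \<Rightarrow> 'a \<Rightarrow> 'a) \<Rightarrow> 'a set \<Rightarrow> 'a rule set \<Rightarrow> 'a set \<Rightarrow> 'a fm" where
  "ranking_fm rk \<sigma> \<Pi> \<iota> = conj_of
     ((\<lambda>a. Imp (Atom a) (Disj
        {| disj_of {Conj {| body_fm B, conj_of ((\<lambda>b. Atom (rk a b)) ` (set (pos B) - \<iota>)) |} |
             B. B \<in> bodies \<Pi> a \<and> set (pos B) - \<iota> \<noteq> {}},
           disj_of {body_fm B | B. B \<in> bodies \<Pi> a \<and> set (pos B) - \<iota> = {}} |})) ` (\<sigma> - \<iota>))"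

definition rank_pairs :: "('a \<Rightarrow> 'a \<Rightarrow> 'a) \<Rightarrow> 'a set \<Rightarrow> 'a rule set \<Rightarrow> 'a set \<Rightarrow> ('a \<times> 'a) set" where
  "rank_pairs rk \<sigma> \<Pi> \<iota> =
     {(a, b). a \<in> \<sigma> - \<iota> \<and> b \<in> \<sigma> - \<iota> \<and> rk a b \<in> atoms (ranking_fm rk \<sigma> \<Pi> \<iota>)}"

definition rank_atoms :: "('a \<Rightarrow> 'a \<Rightarrow> 'a) \<Rightarrow> 'a set \<Rightarrow> 'a rule set \<Rightarrow> 'a set \<Rightarrow> 'a set" where
  "rank_atoms rk \<sigma> \<Pi> \<iota> = {rk a b | a b. (a, b) \<in> rank_pairs rk \<sigma> \<Pi> \<iota>}"

definition rank_vars ::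
  "('a \<Rightarrow> 'v) \<Rightarrow> ('a \<Rightarrow> 'a \<Rightarrow> 'a) \<Rightarrow> 'a set \<Rightarrow> 'a rule set \<Rightarrow> 'a set \<Rightarrow> 'v set" where
  "rank_vars lr rk \<sigma> \<Pi> \<iota> = (\<Union>(a, b)\<in>rank_pairs rk \<sigma> \<Pi> \<iota>. {lr a, lr b})"

text \<open>The constraint \<open>lr a - 1 \<ge> lr b\<close> in the form \<open>lr a + (-1) lr b \<ge> 1\<close>.\<close>

definition rank_constraint :: "('a \<Rightarrow> 'v) \<Rightarrow> 'a \<Rightarrow> 'a \<Rightarrow> 'v lin_constraint" where
  "rank_constraint lr a b = LinC [(1, lr a), (-1, lr b)] Ge 1"

end

theory Submission
  imports Defs
begin

text \<open>An input answer set of \<open>\<Pi>\<close> is a model \<open>X\<close> of \<open>\<Pi>\<close> whose non-input atoms carry an integer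
  ranking such that each of them is the head of a rule whose body holds in \<open>X\<close> and whose positive
  non-input atoms have smaller rank. If \<open>X\<close> is an answer set, the stage at which an atom is first
  derived by the reduct is such a ranking. Conversely, given a ranking, an atom of least rank in
  \<open>X - Y\<close> contradicts the assumption that \<open>Y \<subset> X\<close> satisfies the reduct. The ranking formula together
  with its constraints says that such a ranking exists; since its variables \<open>lr a\<close> are fresh, a
  solution over the original lexicon and a ranking can be glued together.\<close>

section \<open>Satisfaction and atoms of formulas\<close>

lemma fset_Abs_fset: "finite S \<Longrightarrow> fset (Abs_fset S) = S"
  by (simp add: Abs_fset_inverse)

lemma sat_conj_of: "finite S \<Longrightarrow> sat X (conj_of S) \<longleftrightarrow> (\<forall>F\<in>S. sat X F)"
  by (auto simp: conj_of_def fset_Abs_fset)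

lemma sat_disj_of: "finite S \<Longrightarrow> sat X (disj_of S) \<longleftrightarrow> (\<exists>F\<in>S. sat X F)"
  by (auto simp: disj_of_def fset_Abs_fset)

lemma atoms_conj_of: "finite S \<Longrightarrow> atoms (conj_of S) = (\<Union>F\<in>S. atoms F)"
  by (simp add: conj_of_def fset_Abs_fset)

lemma atoms_disj_of: "finite S \<Longrightarrow> atoms (disj_of S) = (\<Union>F\<in>S. atoms F)"
  by (simp add: disj_of_def fset_Abs_fset)

lemma set_body_eq: "set_body B = set (pos B) \<union> set (neg B) \<union> set (dneg B)"
  by (cases B) auto

lemma set_rule_eq: "set_rule r = set_option (head r) \<union> set_body (body r)"
  by (cases r) auto

lemma sat_body_fm: "sat X (body_fm B) \<longleftrightarrow> set (pos B) \<subseteq> X \<and> sat_neg_part X B"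
  by (auto simp: body_fm_def sat_neg_part_def fset_of_list_elem ball_Un)

lemma atoms_body_fm: "atoms (body_fm B) = set_body B"
  by (auto simp: body_fm_def set_body_eq fset_of_list_elem fset_of_list.rep_eq)

lemma sat_rule_fm:
  "sat X (rule_fm r) \<longleftrightarrow> (sat X (body_fm (body r)) \<longrightarrow> (\<exists>a\<in>X. head r = Some a))"
  by (auto simp: rule_fm_def split: option.splits)

lemma atoms_rule_fm: "atoms (rule_fm r) = set_rule r"
  by (auto simp: rule_fm_def atoms_body_fm set_rule_eq split: option.splits)

text \<open>Applied with \<open>Z\<close> a set of fresh ranking atoms: adding them to an assignment
  does not affect anything that belongs to the program.\<close>

lemma sat_body_fm_Un:
  "set_body B \<inter> Z = {} \<Longrightarrow> sat (X \<union> Z) (body_fm B) \<longleftrightarrow> sat X (body_fm B)"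
  unfolding sat_body_fm sat_neg_part_def set_body_eq by blast

lemma sat_rule_fm_Un:
  assumes "set_rule r \<inter> Z = {}"
  shows "sat (X \<union> Z) (rule_fm r) \<longleftrightarrow> sat X (rule_fm r)"
proof -
  have "sat (X \<union> Z) (body_fm (body r)) \<longleftrightarrow> sat X (body_fm (body r))"
    using assms by (intro sat_body_fm_Un) (auto simp: set_rule_eq)
  then show ?thesis
    using assms by (auto simp: sat_rule_fm set_rule_eq)
qed

lemma bodiesD:
  assumes "B \<in> bodies \<Pi> a"
  shows "a \<in> prog_atoms \<Pi>" "set_body B \<subseteq> prog_atoms \<Pi>"
  using assms unfolding bodies_def prog_atoms_def by (force simp: set_rule_eq)+

lemma finite_bodies:
  assumes "finite \<Pi>"
  shows "finite (bodies \<Pi> a)"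
proof (rule finite_subset)
  show "bodies \<Pi> a \<subseteq> body ` \<Pi>"
    by (force simp: bodies_def)
qed (simp add: assms)

section \<open>Models and atoms of the completion\<close>

lemma sat_IComp:
  assumes "finite \<Pi>" "finite (\<sigma> - \<iota>)"
  shows "sat X (IComp \<sigma> \<Pi> \<iota>) \<longleftrightarrow> sat_prog X \<Pi> \<and>
    (\<forall>a\<in>\<sigma> - \<iota>. a \<in> X \<longrightarrow> (\<exists>B\<in>bodies \<Pi> a. sat X (body_fm B)))"
  using assms by (simp add: IComp_def sat_conj_of sat_disj_of finite_bodies sat_prog_def ball_Un)

text \<open>The antecedents contribute all of \<open>\<sigma> - \<iota>\<close>, including atoms
  that do not occur in the program; the disjunctions add only atoms of bodies.\<close>

lemma atoms_IComp:
  assumes "finite \<Pi>" "finite (\<sigma> - \<iota>)"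
  shows "atoms (IComp \<sigma> \<Pi> \<iota>) = prog_atoms \<Pi> \<union> (\<sigma> - \<iota>)"
proof -
  have "atoms (IComp \<sigma> \<Pi> \<iota>) =
      prog_atoms \<Pi> \<union> (\<Union>a\<in>\<sigma> - \<iota>. insert a (\<Union>B\<in>bodies \<Pi> a. set_body B))"
    using assms by (simp add: IComp_def atoms_conj_of atoms_disj_of finite_bodies
        atoms_rule_fm atoms_body_fm prog_atoms_def)
  then show ?thesis
    using bodiesD(2)[of _ \<Pi>] by auto
qed

section \<open>Models and atoms of the ranking formula\<close>

definition ranked_support_fm ::
  "('a \<Rightarrow> 'a \<Rightarrow> 'a) \<Rightarrow> 'a rule set \<Rightarrow> 'a set \<Rightarrow> 'a \<Rightarrow> 'a fm" where
  "ranked_support_fm rk \<Pi> \<iota> a = Disj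
     {| disj_of {Conj {| body_fm B, conj_of ((\<lambda>b. Atom (rk a b)) ` (set (pos B) - \<iota>)) |} |
          B. B \<in> bodies \<Pi> a \<and> set (pos B) - \<iota> \<noteq> {}},
        disj_of {body_fm B | B. B \<in> bodies \<Pi> a \<and> set (pos B) - \<iota> = {}} |}"

text \<open>Separates the consequents from the outer conjunction, so that satisfaction and atoms can
  be computed for one \<open>a\<close> at a time.\<close>

lemma ranking_fm_eq:
  "ranking_fm rk \<sigma> \<Pi> \<iota> =
     conj_of ((\<lambda>a. Imp (Atom a) (ranked_support_fm rk \<Pi> \<iota> a)) ` (\<sigma> - \<iota>))"
  by (simp only: ranking_fm_def ranked_support_fm_def)

text \<open>The two disjunctions merge into one: for a body with no positive non-input atoms, the
  condition on ranking atoms holds vacuously.\<close>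

lemma sat_ranked_support_fm:
  assumes "finite \<Pi>"
  shows "sat X (ranked_support_fm rk \<Pi> \<iota> a) \<longleftrightarrow>
    (\<exists>B\<in>bodies \<Pi> a. sat X (body_fm B) \<and> (\<forall>b\<in>set (pos B) - \<iota>. rk a b \<in> X))"
proof -
  let ?F = "\<lambda>B. Conj {| body_fm B, conj_of ((\<lambda>b. Atom (rk a b)) ` (set (pos B) - \<iota>)) |}"
  have F: "sat X (?F B) \<longleftrightarrow> sat X (body_fm B) \<and> (\<forall>b\<in>set (pos B) - \<iota>. rk a b \<in> X)" for B
    by (simp add: sat_conj_of)
  have "sat X (disj_of {?F B | B. B \<in> bodies \<Pi> a \<and> set (pos B) - \<iota> \<noteq> {}}) \<longleftrightarrow>
      (\<exists>B\<in>bodies \<Pi> a. set (pos B) - \<iota> \<noteq> {} \<and> sat X (?F B))"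
    using finite_bodies[OF assms, of a] by (subst sat_disj_of) (simp, blast)
  moreover have "sat X (disj_of {body_fm B | B. B \<in> bodies \<Pi> a \<and> set (pos B) - \<iota> = {}}) \<longleftrightarrow>
      (\<exists>B\<in>bodies \<Pi> a. set (pos B) - \<iota> = {} \<and> sat X (body_fm B))"
    using finite_bodies[OF assms, of a] by (subst sat_disj_of) (simp, blast)
  ultimately show ?thesis
    unfolding ranked_support_fm_def sat_Disj_iff F finsert_iff by blast
qed

lemma atoms_ranked_support_fm:
  assumes "finite \<Pi>"
  shows "atoms (ranked_support_fm rk \<Pi> \<iota> a) =
    (\<Union>B\<in>bodies \<Pi> a. set_body B \<union> rk a ` (set (pos B) - \<iota>))"
proof -
  let ?F = "\<lambda>B. Conj {| body_fm B, conj_of ((\<lambda>b. Atom (rk a b)) ` (set (pos B) - \<iota>)) |}"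
  have F: "atoms (?F B) = set_body B \<union> rk a ` (set (pos B) - \<iota>)" for B
    by (simp add: atoms_conj_of atoms_body_fm UNION_singleton_eq_range)
  have "atoms (disj_of {?F B | B. B \<in> bodies \<Pi> a \<and> set (pos B) - \<iota> \<noteq> {}}) =
      (\<Union>B\<in>{B \<in> bodies \<Pi> a. set (pos B) - \<iota> \<noteq> {}}. atoms (?F B))"
    using finite_bodies[OF assms, of a] by (subst atoms_disj_of) (simp, blast)
  moreover have "atoms (disj_of {body_fm B | B. B \<in> bodies \<Pi> a \<and> set (pos B) - \<iota> = {}}) =
      (\<Union>B\<in>{B \<in> bodies \<Pi> a. set (pos B) - \<iota> = {}}. set_body B)"
    using finite_bodies[OF assms, of a]
    by (subst atoms_disj_of) (simp, auto simp: atoms_body_fm)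
  ultimately show ?thesis
    unfolding ranked_support_fm_def F by auto
qed

lemma sat_ranking_fm:
  assumes "finite \<Pi>" "finite (\<sigma> - \<iota>)"
  shows "sat X (ranking_fm rk \<sigma> \<Pi> \<iota>) \<longleftrightarrow>
    (\<forall>a\<in>\<sigma> - \<iota>. a \<in> X \<longrightarrow> (\<exists>B\<in>bodies \<Pi> a. sat X (body_fm B) \<and>
       (\<forall>b\<in>set (pos B) - \<iota>. rk a b \<in> X)))"
  using assms by (simp add: ranking_fm_eq sat_conj_of sat_ranked_support_fm)

lemma atoms_ranking_fm:
  assumes "finite \<Pi>" "finite (\<sigma> - \<iota>)"
  shows "atoms (ranking_fm rk \<sigma> \<Pi> \<iota>) =
    (\<Union>a\<in>\<sigma> - \<iota>. insert a (\<Union>B\<in>bodies \<Pi> a. set_body B \<union> rk a ` (set (pos B) - \<iota>)))"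
  using assms by (simp add: ranking_fm_eq atoms_conj_of atoms_ranked_support_fm)

section \<open>Input answer sets and rankings\<close>

text \<open>Ranks are integers because they will be read off from a valuation. Over the integers,
  \<open>l b < l a\<close> is the same as \<open>l a - 1 \<ge> l b\<close>.\<close>

definition ranking :: "'a rule set \<Rightarrow> 'a set \<Rightarrow> 'a set \<Rightarrow> ('a \<Rightarrow> int) \<Rightarrow> bool" where
  "ranking \<Pi> \<iota> X l \<longleftrightarrow> (\<forall>a\<in>X - \<iota>. \<exists>B\<in>bodies \<Pi> a. sat X (body_fm B) \<and>
     (\<forall>b\<in>set (pos B) - \<iota>. l b < l a))"

text \<open>Facts have an empty negative part and so survive in the reduct, where they force the
  inputs into \<open>Y\<close>. For the other rules, \<open>X\<close> decides which ones remain and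
  \<open>Y\<close> is tested on what remains of them.\<close>

lemma sat_prog_reduct_iff:
  "sat_prog Y (reduct (\<Pi> \<union> fact ` (X \<inter> \<iota>)) X) \<longleftrightarrow> X \<inter> \<iota> \<subseteq> Y \<and>
    (\<forall>r\<in>\<Pi>. sat_neg_part X (body r) \<longrightarrow> set (pos (body r)) \<subseteq> Y \<longrightarrow> (\<exists>a\<in>Y. head r = Some a))"
proof -
  have "reduct (\<Pi> \<union> fact ` (X \<inter> \<iota>)) X =
      (\<lambda>r. Rule (head r) (Body (pos (body r)) [] [])) ` {r\<in>\<Pi>. sat_neg_part X (body r)} \<union>
      fact ` (X \<inter> \<iota>)"
    unfolding reduct_def fact_def by (force simp: sat_neg_part_def)
  then show ?thesis
    by (auto simp: sat_prog_def sat_rule_fm sat_body_fm sat_neg_part_def fact_def ball_Un)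
qed

text \<open>For \<open>Y = X\<close> the two tests on a rule recombine into satisfaction of its
  whole body, and the input facts hold trivially.\<close>

lemma sat_prog_reduct_self:
  "sat_prog X (reduct (\<Pi> \<union> fact ` (X \<inter> \<iota>)) X) \<longleftrightarrow> sat_prog X \<Pi>"
  unfolding sat_prog_reduct_iff by (auto simp: sat_prog_def sat_rule_fm sat_body_fm)

text \<open>The iterates of the immediate consequence operator of the reduct, started at the inputs.
  Keeping the previous stage makes the sequence increasing.\<close>

primrec stage :: "'a rule set \<Rightarrow> 'a set \<Rightarrow> 'a set \<Rightarrow> nat \<Rightarrow> 'a set" where
  "stage \<Pi> \<iota> X 0 = X \<inter> \<iota>"
| "stage \<Pi> \<iota> X (Suc n) = stage \<Pi> \<iota> X n \<union>
     {a. \<exists>B\<in>bodies \<Pi> a. sat_neg_part X B \<and> set (pos B) \<subseteq> stage \<Pi> \<iota> X n}"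

lemma stage_mono: "m \<le> n \<Longrightarrow> stage \<Pi> \<iota> X m \<subseteq> stage \<Pi> \<iota> X n"
  by (rule lift_Suc_mono_le) auto

lemma stage_subset:
  assumes "sat_prog X \<Pi>"
  shows "stage \<Pi> \<iota> X n \<subseteq> X"
proof (induction n)
  case (Suc n)
  have "a \<in> X" if "B \<in> bodies \<Pi> a" "sat_neg_part X B" "set (pos B) \<subseteq> stage \<Pi> \<iota> X n" for a B
    using assms that Suc unfolding sat_prog_def bodies_def
    by (force simp: sat_rule_fm sat_body_fm)
  with Suc show ?case by auto
qed simp

text \<open>Positive parts of bodies are finite, so a rule that is applicable to the union of all
  stages is already applicable at some finite stage.\<close>

lemma stage_finite_subset:
  assumes "finite S" "S \<subseteq> (\<Union>n. stage \<Pi> \<iota> X n)"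
  shows "\<exists>n. S \<subseteq> stage \<Pi> \<iota> X n"
  using assms
proof (induction S rule: finite_induct)
  case (insert x S)
  then obtain m n where "S \<subseteq> stage \<Pi> \<iota> X m" "x \<in> stage \<Pi> \<iota> X n"
    by auto
  then have "insert x S \<subseteq> stage \<Pi> \<iota> X (max m n)"
    using stage_mono[of m "max m n" \<Pi> \<iota> X] stage_mono[of n "max m n" \<Pi> \<iota> X] by auto
  then show ?case ..
qed simp

text \<open>The union of the stages lies inside \<open>X\<close> and satisfies the reduct, so
  minimality of \<open>X\<close> leaves no room for a proper inclusion.\<close>

lemma input_answer_set_stages:
  assumes "input_answer_set \<Pi> \<iota> X"
  shows "X = (\<Union>n. stage \<Pi> \<iota> X n)"
proof -
  let ?U = "\<Union>n. stage \<Pi> \<iota> X n"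
  have X: "sat_prog X \<Pi>"
    and min: "\<And>Y. Y \<subset> X \<Longrightarrow> \<not> sat_prog Y (reduct (\<Pi> \<union> fact ` (X \<inter> \<iota>)) X)"
    using assms unfolding input_answer_set_def answer_set_def sat_prog_reduct_self by auto
  have sub: "?U \<subseteq> X"
    using stage_subset[OF X] by blast
  have "\<exists>a\<in>?U. head r = Some a"
    if r: "r \<in> \<Pi>" "sat_neg_part X (body r)" "set (pos (body r)) \<subseteq> ?U" for r
  proof -
    obtain n where n: "set (pos (body r)) \<subseteq> stage \<Pi> \<iota> X n"
      using stage_finite_subset r(3) by blast
    \<comment> \<open>A rule without head atom cannot occur here: its body would hold in
      \<open>X\<close>, which is a model of the program.\<close>
    obtain a where a: "head r = Some a"
      using X r sub unfolding sat_prog_def sat_rule_fm sat_body_fm by blast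
    then have "body r \<in> bodies \<Pi> a"
      using r(1) by (cases r) (simp add: bodies_def)
    then have "a \<in> stage \<Pi> \<iota> X (Suc n)"
      using n r(2) by auto
    with a show ?thesis by blast
  qed
  moreover have "X \<inter> \<iota> \<subseteq> ?U"
    using stage.simps(1)[of \<Pi> \<iota> X] by blast
  ultimately have "sat_prog ?U (reduct (\<Pi> \<union> fact ` (X \<inter> \<iota>)) X)"
    unfolding sat_prog_reduct_iff by blast
  with min sub show ?thesis by blast
qed

lemma input_answer_set_imp_ranking:
  assumes "input_answer_set \<Pi> \<iota> X"
  shows "\<exists>l. ranking \<Pi> \<iota> X l"
proof
  define lev where "lev a = (LEAST n. a \<in> stage \<Pi> \<iota> X n)" for a
  note U = input_answer_set_stages[OF assms]
  show "ranking \<Pi> \<iota> X (\<lambda>a. int (lev a))"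
    unfolding ranking_def
  proof
    fix a assume a: "a \<in> X - \<iota>"
    then have in_lev: "a \<in> stage \<Pi> \<iota> X (lev a)"
      using U unfolding lev_def by (metis DiffD1 LeastI UN_E)
    \<comment> \<open>Stage 0 consists of input atoms only, so \<open>a\<close> enters at a
      successor stage, through a rule whose positive part lies in the stage before.\<close>
    with a obtain n where n: "lev a = Suc n"
      by (cases "lev a") auto
    have "a \<notin> stage \<Pi> \<iota> X n"
      using n not_less_Least[of n "\<lambda>n. a \<in> stage \<Pi> \<iota> X n"] unfolding lev_def by simp
    then obtain B where B: "B \<in> bodies \<Pi> a" "sat_neg_part X B" "set (pos B) \<subseteq> stage \<Pi> \<iota> X n"
      using in_lev n by auto
    have "lev b < lev a" if "b \<in> set (pos B)" for b
      using B(3) that n unfolding lev_def by (metis Least_le le_imp_less_Suc subsetD)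
    moreover have "sat X (body_fm B)"
      using B(2,3) U by (auto simp: sat_body_fm)
    ultimately show "\<exists>B\<in>bodies \<Pi> a. sat X (body_fm B) \<and>
        (\<forall>b\<in>set (pos B) - \<iota>. int (lev b) < int (lev a))"
      using B(1) by auto
  qed
qed

lemma ranking_imp_input_answer_set:
  assumes "finite (X - \<iota>)" "sat_prog X \<Pi>" "ranking \<Pi> \<iota> X l"
  shows "input_answer_set \<Pi> \<iota> X"
  unfolding input_answer_set_def answer_set_def sat_prog_reduct_self
proof (intro conjI allI impI notI)
  fix Y assume "Y \<subset> X" and Y: "sat_prog Y (reduct (\<Pi> \<union> fact ` (X \<inter> \<iota>)) X)"
  then have "X \<inter> \<iota> \<subseteq> Y" and "X - Y \<noteq> {}"
    by (auto simp: sat_prog_reduct_iff)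
  \<comment> \<open>The integers are not well-founded, so an atom of least rank exists only because
    \<open>X - Y\<close> is finite; it is contained in \<open>X - \<iota>\<close> since
    \<open>Y\<close> contains the inputs of \<open>X\<close>.\<close>
  then have fin: "finite (X - Y)"
    using assms(1) by (auto intro: finite_subset[of "X - Y" "X - \<iota>"])
  define a where "a = arg_min_on l (X - Y)"
  have a: "a \<in> X - Y" and least: "\<And>b. b \<in> X - Y \<Longrightarrow> l a \<le> l b"
    using arg_min_if_finite[OF fin \<open>X - Y \<noteq> {}\<close>, of l] unfolding a_def by (auto simp: not_less)
  then obtain B where B: "B \<in> bodies \<Pi> a" "sat X (body_fm B)"
    and less: "\<And>b. b \<in> set (pos B) - \<iota> \<Longrightarrow> l b < l a"
    using assms(3) \<open>X \<inter> \<iota> \<subseteq> Y\<close> unfolding ranking_def by blast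
  \<comment> \<open>A positive atom of \<open>B\<close> outside \<open>Y\<close> would be a
    non-input atom of \<open>X - Y\<close> ranked below \<open>a\<close>.\<close>
  have "set (pos B) \<subseteq> Y"
    using B(2) less least \<open>X \<inter> \<iota> \<subseteq> Y\<close> unfolding sat_body_fm by force
  then have "a \<in> Y"
    using Y B unfolding sat_prog_reduct_iff bodies_def sat_body_fm by force
  with a show False by simp
qed (fact assms(2))

theorem input_answer_set_iff_ranking:
  assumes "finite (X - \<iota>)"
  shows "input_answer_set \<Pi> \<iota> X \<longleftrightarrow> sat_prog X \<Pi> \<and> (\<exists>l. ranking \<Pi> \<iota> X l)"
proof -
  have "sat_prog X \<Pi>" if "input_answer_set \<Pi> \<iota> X"
    using that unfolding input_answer_set_def answer_set_def sat_prog_reduct_self by simp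
  then show ?thesis
    using input_answer_set_imp_ranking ranking_imp_input_answer_set[OF assms] by blast
qed

section \<open>Constraints\<close>

text \<open>Under the assumption, the positive and the negated constraints together cover exactly
  \<open>A \<inter> \<sigma>\<^sub>i\<close>, so they combine into one equivalence per atom.\<close>

lemma has_solution_gcsp_iff:
  assumes "X \<inter> \<sigma>\<^sub>i \<subseteq> A"
  shows "has_solution (gcsp A \<sigma>\<^sub>i \<gamma> X) \<longleftrightarrow> (\<exists>\<nu>. \<forall>a\<in>A \<inter> \<sigma>\<^sub>i. a \<in> X \<longleftrightarrow> sat_con \<nu> (\<gamma> a))"
proof -
  have "(\<forall>l\<in>gcsp A \<sigma>\<^sub>i \<gamma> X. sat_lit \<nu> l) \<longleftrightarrow>
      (\<forall>a\<in>X \<inter> \<sigma>\<^sub>i. sat_con \<nu> (\<gamma> a)) \<and> (\<forall>a\<in>A \<inter> \<sigma>\<^sub>i - X. \<not> sat_con \<nu> (\<gamma> a))" for \<nu>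
    unfolding gcsp_def ball_Un by auto
  moreover have "(\<forall>a\<in>X \<inter> \<sigma>\<^sub>i. sat_con \<nu> (\<gamma> a)) \<and> (\<forall>a\<in>A \<inter> \<sigma>\<^sub>i - X. \<not> sat_con \<nu> (\<gamma> a)) \<longleftrightarrow>
      (\<forall>a\<in>A \<inter> \<sigma>\<^sub>i. a \<in> X \<longleftrightarrow> sat_con \<nu> (\<gamma> a))" for \<nu>
    using assms by blast
  ultimately show ?thesis
    by (simp add: has_solution_def)
qed

text \<open>Allows a valuation to be redefined on the ranking variables without disturbing the
  constraints over the original lexicon.\<close>

lemma sat_con_cong:
  assumes "\<And>v. v \<in> con_vars c \<Longrightarrow> \<nu> v = \<nu>' v"
  shows "sat_con \<nu> c \<longleftrightarrow> sat_con \<nu>' c"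
proof (cases c)
  case (LinC ts R k)
  then have "map (\<lambda>(a, x). a * \<nu> x) ts = map (\<lambda>(a, x). a * \<nu>' x) ts"
    using assms by force
  with LinC show ?thesis by (simp only: sat_con.simps)
qed

lemma sat_rank_constraint: "sat_con \<nu> (rank_constraint lr a b) \<longleftrightarrow> \<nu> (lr b) < \<nu> (lr a)"
  by (auto simp: rank_constraint_def)

lemma con_vars_rank_constraint: "con_vars (rank_constraint lr a b) = {lr a, lr b}"
  by (simp add: rank_constraint_def)

text \<open>Constraints are compared as expressions, which reduces injectivity of
  \<open>\<gamma>'\<close> on ranking atoms to injectivity of \<open>lr\<close>.\<close>

lemma rank_constraint_eq_iff:
  "rank_constraint lr a b = rank_constraint lr c d \<longleftrightarrow> lr a = lr c \<and> lr b = lr d"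
  by (simp add: rank_constraint_def)

section \<open>Answer sets as models of the constraint formula\<close>

text \<open>Program atoms and ranking atoms share the type \<open>'a\<close>, and all variables
  share \<open>'v\<close>; the assumptions on \<open>rk\<close> and \<open>lr\<close> express that
  the ranking atoms and variables are new and pairwise distinct. The first conjunct of the
  conclusion confirms that the target is a well-formed constraint formula.\<close>

theorem theorem10:
  fixes \<Pi> :: "'a rule set" and \<sigma>\<^sub>r \<sigma>\<^sub>i X :: "'a set" and V :: "'v set"
    and \<gamma> \<gamma>' :: "'a \<Rightarrow> 'v lin_constraint"
    and lr :: "'a \<Rightarrow> 'v" and rk :: "'a \<Rightarrow> 'a \<Rightarrow> 'a"
  assumes finite_vocabulary: "finite \<sigma>\<^sub>r"
    and P: "cas_program V \<sigma>\<^sub>r \<sigma>\<^sub>i (\<Pi>, int_constraints V, \<gamma>)"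
    and X: "X \<subseteq> \<sigma>\<^sub>r \<union> \<sigma>\<^sub>i"
    and rank_variables: "inj_on lr \<sigma>\<^sub>r" "V \<inter> rank_vars lr rk (\<sigma>\<^sub>r \<union> \<sigma>\<^sub>i) \<Pi> \<sigma>\<^sub>i = {}"
    and rank_atoms_fresh: "inj_on (\<lambda>(a, b). rk a b) (\<sigma>\<^sub>r \<times> \<sigma>\<^sub>r)"
      "\<And>a b. a \<in> \<sigma>\<^sub>r \<Longrightarrow> b \<in> \<sigma>\<^sub>r \<Longrightarrow> rk a b \<notin> \<sigma>\<^sub>r \<union> \<sigma>\<^sub>i"
    and \<gamma>'_old: "\<And>a. a \<in> \<sigma>\<^sub>i \<Longrightarrow> \<gamma>' a = \<gamma> a"
    and \<gamma>'_rank: "\<And>a b. (a, b) \<in> rank_pairs rk (\<sigma>\<^sub>r \<union> \<sigma>\<^sub>i) \<Pi> \<sigma>\<^sub>i \<Longrightarrow>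
      \<gamma>' (rk a b) = rank_constraint lr a b"
  shows "let \<sigma> = \<sigma>\<^sub>r \<union> \<sigma>\<^sub>i; \<sigma>R = rank_atoms rk \<sigma> \<Pi> \<sigma>\<^sub>i; \<Sigma>R = rank_vars lr rk \<sigma> \<Pi> \<sigma>\<^sub>i;
           C = (Conj {| IComp \<sigma> \<Pi> \<sigma>\<^sub>i, ranking_fm rk \<sigma> \<Pi> \<sigma>\<^sub>i |},
                int_constraints V \<union> int_constraints \<Sigma>R, \<gamma>')
         in constraint_formula (V \<union> \<Sigma>R) \<sigma>\<^sub>r (\<sigma>\<^sub>i \<union> \<sigma>R) C \<and>
            (cas_answer_set \<sigma>\<^sub>i (\<Pi>, int_constraints V, \<gamma>) X \<longleftrightarrow>
             (\<exists>X\<^sub>i. X\<^sub>i \<subseteq> \<sigma>R \<and> cfm_model (\<sigma>\<^sub>i \<union> \<sigma>R) C (X \<union> X\<^sub>i)))"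
proof -
  define \<sigma> where "\<sigma> = \<sigma>\<^sub>r \<union> \<sigma>\<^sub>i"
  define R where "R = rank_pairs rk \<sigma> \<Pi> \<sigma>\<^sub>i"
  define \<sigma>R where "\<sigma>R = rank_atoms rk \<sigma> \<Pi> \<sigma>\<^sub>i"
  define \<Sigma>R where "\<Sigma>R = rank_vars lr rk \<sigma> \<Pi> \<sigma>\<^sub>i"
  define F where "F = Conj {| IComp \<sigma> \<Pi> \<sigma>\<^sub>i, ranking_fm rk \<sigma> \<Pi> \<sigma>\<^sub>i |}"
  have disj: "\<sigma>\<^sub>r \<inter> \<sigma>\<^sub>i = {}" and fin: "finite \<Pi>" and over: "prog_atoms \<Pi> \<subseteq> \<sigma>"
    and \<gamma>: "\<gamma> ` \<sigma>\<^sub>i \<subseteq> int_constraints V" "inj_on \<gamma> \<sigma>\<^sub>i"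
    using P by (auto simp: program_over_def \<sigma>_def)
  have diff: "\<sigma> - \<sigma>\<^sub>i = \<sigma>\<^sub>r"
    using disj by (auto simp: \<sigma>_def)
  have finr: "finite (\<sigma> - \<sigma>\<^sub>i)"
    using finite_vocabulary by (simp add: diff)
  have R_subset: "R \<subseteq> \<sigma>\<^sub>r \<times> \<sigma>\<^sub>r"
    by (auto simp: R_def rank_pairs_def diff)
  have \<sigma>R_eq: "\<sigma>R = (\<lambda>(a, b). rk a b) ` R"
    by (auto simp: \<sigma>R_def R_def rank_atoms_def)
  have \<Sigma>R_I: "lr a \<in> \<Sigma>R" "lr b \<in> \<Sigma>R" if "(a, b) \<in> R" for a b
    using that by (auto simp: \<Sigma>R_def R_def rank_vars_def)
  have V_disj: "V \<inter> \<Sigma>R = {}"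
    using rank_variables(2) by (simp add: \<Sigma>R_def \<sigma>_def)
  have inj_R: "inj_on (\<lambda>(a, b). rk a b) R"
    using inj_on_subset[OF rank_atoms_fresh(1) R_subset] .
  have fresh: "\<sigma>R \<inter> \<sigma> = {}"
    using rank_atoms_fresh(2) R_subset by (fastforce simp: \<sigma>R_eq \<sigma>_def)
  have \<gamma>'_R: "\<gamma>' (rk a b) = rank_constraint lr a b" if "(a, b) \<in> R" for a b
    using \<gamma>'_rank that by (simp add: R_def \<sigma>_def)
  \<comment> \<open>Every pair consulted by the ranking formula lies in \<open>R\<close>, so
    \<open>\<gamma>'\<close> is known on its ranking atom.\<close>
  have pos_R: "(a, b) \<in> R" if "B \<in> bodies \<Pi> a" "b \<in> set (pos B) - \<sigma>\<^sub>i" "a \<in> \<sigma>\<^sub>r" for a b B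
  proof -
    have "b \<in> \<sigma>\<^sub>r"
      using that bodiesD(2)[OF that(1)] over by (auto simp: set_body_eq \<sigma>_def)
    moreover have "rk a b \<in> atoms (ranking_fm rk \<sigma> \<Pi> \<sigma>\<^sub>i)"
      unfolding atoms_ranking_fm[OF fin finr] diff using that by blast
    ultimately show ?thesis
      using that(3) by (simp add: R_def rank_pairs_def diff)
  qed
  \<comment> \<open>Hence \<open>F\<close> and the program contain the same atoms of
    \<open>\<sigma>\<^sub>i\<close>, and the two GCSPs agree on them.\<close>
  have atoms_F: "atoms F = prog_atoms \<Pi> \<union> \<sigma>\<^sub>r \<union> \<sigma>R"
  proof -
    have "atoms (ranking_fm rk \<sigma> \<Pi> \<sigma>\<^sub>i) \<subseteq> prog_atoms \<Pi> \<union> \<sigma>\<^sub>r \<union> \<sigma>R"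
    proof
      fix c assume "c \<in> atoms (ranking_fm rk \<sigma> \<Pi> \<sigma>\<^sub>i)"
      then show "c \<in> prog_atoms \<Pi> \<union> \<sigma>\<^sub>r \<union> \<sigma>R"
        unfolding atoms_ranking_fm[OF fin finr] diff
        using bodiesD(2)[of _ \<Pi>] pos_R by (fastforce simp: \<sigma>R_eq)
    qed
    moreover have "\<sigma>R \<subseteq> atoms (ranking_fm rk \<sigma> \<Pi> \<sigma>\<^sub>i)"
      by (auto simp: \<sigma>R_eq R_def rank_pairs_def)
    ultimately show ?thesis
      by (auto simp: F_def atoms_IComp[OF fin finr] diff)
  qed
  \<comment> \<open>By freshness, program atoms are decided by \<open>X\<close> and ranking atoms by
    \<open>Z\<close>. The support condition of the completion disappears because the ranking formula
    implies it.\<close>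
  have sat_F: "sat (X \<union> Z) F \<longleftrightarrow> sat_prog X \<Pi> \<and>
      (\<forall>a\<in>X \<inter> \<sigma>\<^sub>r. \<exists>B\<in>bodies \<Pi> a. sat X (body_fm B) \<and>
         (\<forall>b\<in>set (pos B) - \<sigma>\<^sub>i. rk a b \<in> Z))" if Z: "Z \<subseteq> \<sigma>R" for Z
  proof -
    have Z_disj: "Z \<inter> \<sigma> = {}"
      using Z fresh by blast
    have body: "sat (X \<union> Z) (body_fm B) \<longleftrightarrow> sat X (body_fm B)" if "B \<in> bodies \<Pi> a" for a B
      using bodiesD(2)[OF that] over Z_disj by (intro sat_body_fm_Un) blast
    have "sat (X \<union> Z) (rule_fm r) \<longleftrightarrow> sat X (rule_fm r)" if "r \<in> \<Pi>" for r
      using that over Z_disj by (intro sat_rule_fm_Un) (auto simp: prog_atoms_def)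
    then have prog: "sat_prog (X \<union> Z) \<Pi> \<longleftrightarrow> sat_prog X \<Pi>"
      by (simp add: sat_prog_def)
    have rk: "(\<forall>b\<in>set (pos B) - \<sigma>\<^sub>i. rk a b \<in> X \<union> Z) \<longleftrightarrow> (\<forall>b\<in>set (pos B) - \<sigma>\<^sub>i. rk a b \<in> Z)"
      if "B \<in> bodies \<Pi> a" "a \<in> \<sigma>\<^sub>r" for a B
    proof -
      have "rk a b \<notin> X" if "b \<in> set (pos B) - \<sigma>\<^sub>i" for b
        using pos_R[OF \<open>B \<in> bodies \<Pi> a\<close> that \<open>a \<in> \<sigma>\<^sub>r\<close>] fresh X by (force simp: \<sigma>R_eq \<sigma>_def)
      then show ?thesis by blast
    qed
    have "sat (X \<union> Z) F \<longleftrightarrow> sat_prog X \<Pi> \<and>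
        (\<forall>a\<in>\<sigma>\<^sub>r. a \<in> X \<union> Z \<longrightarrow> (\<exists>B\<in>bodies \<Pi> a. sat X (body_fm B) \<and>
           (\<forall>b\<in>set (pos B) - \<sigma>\<^sub>i. rk a b \<in> Z)))"
      unfolding F_def sat_Conj_iff
      \<comment> \<open>Without \<open>Un_iff\<close> and \<open>Diff_iff\<close>, memberships keep
        the shape in which the local fact \<open>rk\<close> can rewrite them.\<close>
      by (simp add: sat_IComp[OF fin finr] sat_ranking_fm[OF fin finr] prog diff body rk
          del: Un_iff Diff_iff cong: bex_cong ball_cong) blast
    then show ?thesis
      using Z_disj by (auto simp: \<sigma>_def)
  qed
  have cf: "constraint_formula (V \<union> \<Sigma>R) \<sigma>\<^sub>r (\<sigma>\<^sub>i \<union> \<sigma>R)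
      (F, int_constraints V \<union> int_constraints \<Sigma>R, \<gamma>')"
  proof -
    have old: "\<gamma>' a \<in> int_constraints V" if "a \<in> \<sigma>\<^sub>i" for a
      using \<gamma>(1) \<gamma>'_old that by auto
    have new: "\<gamma>' c \<in> int_constraints \<Sigma>R" "con_vars (\<gamma>' c) \<noteq> {}" if "c \<in> \<sigma>R" for c
      using that \<gamma>'_R \<Sigma>R_I by (auto simp: \<sigma>R_eq int_constraints_def con_vars_rank_constraint)
    have "inj_on \<gamma>' \<sigma>\<^sub>i"
      using \<gamma>(2) \<gamma>'_old by (simp cong: inj_on_cong)
    moreover have "inj_on \<gamma>' \<sigma>R"
    proof (rule inj_onI)
      fix x y assume "x \<in> \<sigma>R" "y \<in> \<sigma>R" and eq: "\<gamma>' x = \<gamma>' y"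
      then obtain a b c d where R: "(a, b) \<in> R" "(c, d) \<in> R" and xy: "x = rk a b" "y = rk c d"
        by (auto simp: \<sigma>R_eq)
      then have "lr a = lr c" "lr b = lr d"
        using eq by (simp_all add: \<gamma>'_R rank_constraint_eq_iff)
      moreover have "a \<in> \<sigma>\<^sub>r" "b \<in> \<sigma>\<^sub>r" "c \<in> \<sigma>\<^sub>r" "d \<in> \<sigma>\<^sub>r"
        using R R_subset by auto
      ultimately have "a = c" "b = d"
        using rank_variables(1) by (auto dest: inj_onD)
      with xy show "x = y" by simp
    qed
    \<comment> \<open>Disjointness of the variables separates the two kinds of constraints only
      because a ranking constraint has a variable; a variable-free constraint would belong to both
      lexicons.\<close>
    moreover have "\<gamma>' a \<noteq> \<gamma>' c" if "a \<in> \<sigma>\<^sub>i" "c \<in> \<sigma>R" for a c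
      using old[OF that(1)] new[OF that(2)] V_disj unfolding int_constraints_def
      by (metis Int_greatest mem_Collect_eq subset_empty)
    ultimately have "inj_on \<gamma>' (\<sigma>\<^sub>i \<union> \<sigma>R)"
      unfolding inj_on_def by (metis Un_iff)
    moreover have "\<gamma>' ` (\<sigma>\<^sub>i \<union> \<sigma>R) \<subseteq> int_constraints V \<union> int_constraints \<Sigma>R"
      using old new(1) by blast
    moreover have "int_constraints V \<union> int_constraints \<Sigma>R \<subseteq> int_constraints (V \<union> \<Sigma>R)"
      by (auto simp: int_constraints_def)
    moreover have "\<sigma>\<^sub>r \<inter> (\<sigma>\<^sub>i \<union> \<sigma>R) = {}" "atoms F \<subseteq> \<sigma>\<^sub>r \<union> (\<sigma>\<^sub>i \<union> \<sigma>R)"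
      using disj fresh over by (auto simp: atoms_F \<sigma>_def)
    ultimately show ?thesis by simp
  qed
  have main: "cas_answer_set \<sigma>\<^sub>i (\<Pi>, int_constraints V, \<gamma>) X \<longleftrightarrow>
     (\<exists>X\<^sub>i. X\<^sub>i \<subseteq> \<sigma>R \<and> cfm_model (\<sigma>\<^sub>i \<union> \<sigma>R)
       (F, int_constraints V \<union> int_constraints \<Sigma>R, \<gamma>') (X \<union> X\<^sub>i))"
    (is "?A \<longleftrightarrow> ?M")
  proof
    assume ?A
    then have X_atoms: "X \<subseteq> prog_atoms \<Pi>" and ias: "input_answer_set \<Pi> \<sigma>\<^sub>i X"
      and sol: "has_solution (gcsp (prog_atoms \<Pi>) \<sigma>\<^sub>i \<gamma> X)"
      by auto
    have "finite (X - \<sigma>\<^sub>i)"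
      using X finite_vocabulary by (auto intro: finite_subset[of _ \<sigma>\<^sub>r])
    then obtain l where X_prog: "sat_prog X \<Pi>" and l: "ranking \<Pi> \<sigma>\<^sub>i X l"
      using ias input_answer_set_iff_ranking by blast
    obtain \<nu> where \<nu>: "\<forall>a\<in>prog_atoms \<Pi> \<inter> \<sigma>\<^sub>i. a \<in> X \<longleftrightarrow> sat_con \<nu> (\<gamma> a)"
      using sol has_solution_gcsp_iff[of X \<sigma>\<^sub>i "prog_atoms \<Pi>" \<gamma>] X_atoms by auto
    \<comment> \<open>The witness for the ranking atoms: those whose inequality is true of
      \<open>l\<close>.\<close>
    define Z where "Z = (\<lambda>(a, b). rk a b) ` {(a, b)\<in>R. l b < l a}"
    \<comment> \<open>The glued valuation: the given solution on \<open>V\<close>, and on a ranking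
      variable the rank of the atom that owns it. Values at all other variables are
      irrelevant.\<close>
    define \<nu>' where "\<nu>' v = (if v \<in> V then \<nu> v else l (inv_into \<sigma>\<^sub>r lr v))" for v
    have Z_subset: "Z \<subseteq> \<sigma>R"
      by (auto simp: Z_def \<sigma>R_eq)
    \<comment> \<open>\<open>Z\<close> is an image, so injectivity of \<open>rk\<close> has to
      exclude that \<open>rk a b\<close> comes from another pair.\<close>
    have Z_iff: "rk a b \<in> Z \<longleftrightarrow> l b < l a" if "(a, b) \<in> R" for a b
    proof -
      have "(a, b) = (c, d)" if "(c, d) \<in> R" "rk a b = rk c d" for c d
        using inj_onD[OF inj_R, of "(a, b)" "(c, d)"] that \<open>(a, b) \<in> R\<close> by simp
      moreover have "rk a b \<in> Z \<longleftrightarrow> (\<exists>c d. (c, d) \<in> R \<and> l d < l c \<and> rk a b = rk c d)"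
        by (auto simp: Z_def image_iff)
      ultimately show ?thesis
        using that by (metis prod.inject)
    qed
    have \<nu>'_lr: "\<nu>' (lr a) = l a" if "a \<in> \<sigma>\<^sub>r" "lr a \<in> \<Sigma>R" for a
    proof -
      have "lr a \<notin> V"
        using that(2) V_disj by blast
      then show ?thesis
        using inv_into_f_f[OF rank_variables(1) that(1)] by (simp add: \<nu>'_def)
    qed
    have "\<exists>B\<in>bodies \<Pi> a. sat X (body_fm B) \<and> (\<forall>b\<in>set (pos B) - \<sigma>\<^sub>i. rk a b \<in> Z)"
      if "a \<in> X \<inter> \<sigma>\<^sub>r" for a
    proof -
      have "a \<in> X - \<sigma>\<^sub>i"
        using that disj by auto
      then obtain B where B: "B \<in> bodies \<Pi> a" "sat X (body_fm B)"
        and less: "\<forall>b\<in>set (pos B) - \<sigma>\<^sub>i. l b < l a"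
        using l unfolding ranking_def by auto
      have "rk a b \<in> Z" if "b \<in> set (pos B) - \<sigma>\<^sub>i" for b
        using Z_iff[OF pos_R[OF B(1) that]] less that \<open>a \<in> X \<inter> \<sigma>\<^sub>r\<close> by simp
      with B show ?thesis by auto
    qed
    then have "sat (X \<union> Z) F"
      using sat_F[OF Z_subset] X_prog by simp
    moreover have XZ: "X \<union> Z \<subseteq> atoms F"
      using X_atoms Z_subset by (auto simp: atoms_F)
    moreover have "has_solution (gcsp (atoms F) (\<sigma>\<^sub>i \<union> \<sigma>R) \<gamma>' (X \<union> Z))"
    proof -
      have "c \<in> X \<union> Z \<longleftrightarrow> sat_con \<nu>' (\<gamma>' c)" if "c \<in> atoms F" "c \<in> \<sigma>\<^sub>i" for c
      proof -
        have "sat_con \<nu>' (\<gamma> c) \<longleftrightarrow> sat_con \<nu> (\<gamma> c)"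
          using \<gamma>(1) that(2) by (intro sat_con_cong) (auto simp: \<nu>'_def int_constraints_def)
        moreover have "c \<in> prog_atoms \<Pi>" "c \<notin> Z"
          using that fresh disj Z_subset by (auto simp: atoms_F \<sigma>_def)
        ultimately show ?thesis
          using \<nu> that(2) \<gamma>'_old by auto
      qed
      moreover have "c \<in> X \<union> Z \<longleftrightarrow> sat_con \<nu>' (\<gamma>' c)" if "c \<in> \<sigma>R" for c
      proof -
        obtain a b where ab: "(a, b) \<in> R" "c = rk a b"
          using \<open>c \<in> \<sigma>R\<close> by (auto simp: \<sigma>R_eq)
        have "c \<notin> X"
          using that fresh X by (auto simp: \<sigma>_def)
        moreover have "\<nu>' (lr a) = l a" "\<nu>' (lr b) = l b"
          using \<nu>'_lr[of a] \<nu>'_lr[of b] \<Sigma>R_I[OF ab(1)] ab(1) R_subset by auto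
        ultimately show ?thesis
          using ab Z_iff \<gamma>'_R by (simp add: sat_rank_constraint)
      qed
      ultimately show ?thesis
        using XZ by (subst has_solution_gcsp_iff) blast+
    qed
    ultimately show ?M
      using Z_subset by auto
  next
    assume ?M
    then obtain Z where Z: "Z \<subseteq> \<sigma>R" "X \<union> Z \<subseteq> atoms F" "sat (X \<union> Z) F"
      and "has_solution (gcsp (atoms F) (\<sigma>\<^sub>i \<union> \<sigma>R) \<gamma>' (X \<union> Z))"
      by auto
    then obtain \<nu> where \<nu>: "\<forall>c\<in>atoms F \<inter> (\<sigma>\<^sub>i \<union> \<sigma>R). c \<in> X \<union> Z \<longleftrightarrow> sat_con \<nu> (\<gamma>' c)"
      using has_solution_gcsp_iff[of "X \<union> Z" "\<sigma>\<^sub>i \<union> \<sigma>R" "atoms F" \<gamma>'] by auto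
    \<comment> \<open>The true ranking atoms impose their inequalities on the solution, so its
      values at the variables \<open>lr a\<close> will serve as ranks.\<close>
    have Z_lt: "\<nu> (lr b) < \<nu> (lr a)" if "(a, b) \<in> R" "rk a b \<in> Z" for a b
    proof -
      have "rk a b \<in> atoms F \<inter> (\<sigma>\<^sub>i \<union> \<sigma>R)"
        using that(2) Z(1) by (auto simp: atoms_F)
      then have "sat_con \<nu> (\<gamma>' (rk a b))"
        using \<nu> that(2) by blast
      then show ?thesis
        by (simp only: \<gamma>'_R[OF that(1)] sat_rank_constraint)
    qed
    have X_prog: "sat_prog X \<Pi>"
      and sup: "\<forall>a\<in>X \<inter> \<sigma>\<^sub>r. \<exists>B\<in>bodies \<Pi> a. sat X (body_fm B) \<and>
        (\<forall>b\<in>set (pos B) - \<sigma>\<^sub>i. rk a b \<in> Z)"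
      using sat_F[OF Z(1)] Z(3) by auto
    have "ranking \<Pi> \<sigma>\<^sub>i X (\<lambda>a. \<nu> (lr a))"
      unfolding ranking_def
    proof
      fix a assume "a \<in> X - \<sigma>\<^sub>i"
      then have a: "a \<in> X \<inter> \<sigma>\<^sub>r"
        using X by blast
      then obtain B where B: "B \<in> bodies \<Pi> a" "sat X (body_fm B)"
        and rk: "\<forall>b\<in>set (pos B) - \<sigma>\<^sub>i. rk a b \<in> Z"
        using sup by auto
      have "\<nu> (lr b) < \<nu> (lr a)" if "b \<in> set (pos B) - \<sigma>\<^sub>i" for b
        using Z_lt[OF pos_R[OF B(1) that]] rk that a by simp
      with B show "\<exists>B\<in>bodies \<Pi> a. sat X (body_fm B) \<and>
          (\<forall>b\<in>set (pos B) - \<sigma>\<^sub>i. \<nu> (lr b) < \<nu> (lr a))"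
        by auto
    qed
    moreover have "finite (X - \<sigma>\<^sub>i)"
      using X finite_vocabulary by (auto intro: finite_subset[of _ \<sigma>\<^sub>r])
    ultimately have "input_answer_set \<Pi> \<sigma>\<^sub>i X"
      using X_prog ranking_imp_input_answer_set by blast
    \<comment> \<open>\<open>atoms F\<close> contains all of \<open>\<sigma>\<^sub>r\<close>, so for
      a regular atom membership in \<open>F\<close> says nothing; being supported makes it the head
      of a rule.\<close>
    moreover have X_atoms: "X \<subseteq> prog_atoms \<Pi>"
    proof
      fix a assume a: "a \<in> X"
      show "a \<in> prog_atoms \<Pi>"
      proof (cases "a \<in> \<sigma>\<^sub>r")
        case True
        with a sup obtain B where "B \<in> bodies \<Pi> a" by auto
        then show ?thesis by (rule bodiesD(1))
      next
        case False
        with a X Z(2) fresh show ?thesis by (auto simp: atoms_F \<sigma>_def)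
      qed
    qed
    moreover have "a \<in> X \<longleftrightarrow> sat_con \<nu> (\<gamma> a)" if "a \<in> prog_atoms \<Pi> \<inter> \<sigma>\<^sub>i" for a
    proof -
      have "a \<notin> Z" "a \<in> atoms F \<inter> (\<sigma>\<^sub>i \<union> \<sigma>R)"
        using that Z(1) fresh by (auto simp: \<sigma>_def atoms_F)
      then have "a \<in> X \<longleftrightarrow> sat_con \<nu> (\<gamma>' a)"
        using \<nu> by blast
      then show ?thesis
        using \<gamma>'_old that by simp
    qed
    then have "has_solution (gcsp (prog_atoms \<Pi>) \<sigma>\<^sub>i \<gamma> X)"
      using X_atoms by (subst has_solution_gcsp_iff) blast+
    ultimately show ?A by simp
  qed
  from cf main show ?thesis
    unfolding Let_def \<sigma>_def \<sigma>R_def \<Sigma>R_def F_def by blast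
qed

end
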